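(* Let $G_i=(V_i,E_i)$, $i=1,\dots,n$, be disjoint connected undirected graphs with given bridge nodes $l_i\in V_i$, indexed so that $|V_1|\ge|V_2|\ge\dots\ge|V_n|$. Consider all composite graphs $G$ formed from $G_1,\dots,G_n$ whose backbone graph $B$ is a line (path) graph on $\{l_1,\dots,l_n\}$; denote the nodes of $B$ in order from left to right along the path by $l_{s_1},l_{s_2},\dots,l_{s_n}$. Let $c=\lceil n/2\rceil$. Then the coherence $H_C(G)$ is minimized, over all such orderings, by the assignment $$l_{s_c}=l_1,\quad l_{s_{c+1}}=l_2,\quad l_{s_{c-1}}=l_3,\quad l_{s_{c+2}}=l_4,\quad l_{s_{c-2}}=l_5,\ \dots,$$ that is, $l_{s_c}=l_1$, $l_{s_{c+k}}=l_{2k}$ for all $k\ge1$ with $2k\le n$, and $l_{s_{c-k}}=l_{2k+1}$ for all $k\ge1$ with $2k+1\le n$.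
   Context: Composite graph: given disjoint connected undirected graphs $G_i=(V_i,E_i)$, $i=1,\dots,n$, one node $l_i\in V_i$ (the bridge node of $G_i$) is chosen in each. The backbone graph $B=(V_B,E_B)$ is a connected undirected graph on $V_B=\{l_1,\dots,l_n\}$. The composite graph is $G=(V,E)$ with $V=V_1\cup\dots\cup V_n$ and $E=E_1\cup\dots\cup E_n\cup E_B$. Coherence: for a connected graph $G$ with $N$ nodes and (unweighted) Laplacian $L$, consider the noisy consensus dynamics $\dot x=-Lx+\nu$, with $\nu$ a zero-mean, unit-variance white noise. The network coherence is $H_C(G)=\lim_{t\to\infty}\sum_{j=1}^N\mathrm{var}\big(x_j-\frac1N\sum_{k=1}^Nx_k\big)$, which equals $\frac12\mathrm{tr}(L^\dagger)$, where $L^\dagger$ is the Moore–Penrose pseudo-inverse of $L$ (this known equality may be taken as the definition). Smaller coherence is better; "optimal" means minimizing $H_C(G)$. *)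

theory Defs
  imports
    Complex_Main
    "Graph_Theory.Graph_Theory"
    "Jordan_Normal_Form.Matrix"
begin

definition moore_penrose :: "real mat \<Rightarrow> real mat \<Rightarrow> bool" where
  "moore_penrose A X \<longleftrightarrow>
     X \<in> carrier_mat (dim_col A) (dim_row A) \<and>
     A * X * A = A \<and> X * A * X = X \<and>
     transpose_mat (A * X) = A * X \<and> transpose_mat (X * A) = X * A"

text \<open>For real matrices the four Penrose equations have exactly one solution.\<close>

definition pseudo_inverse :: "real mat \<Rightarrow> real mat" where
  "pseudo_inverse A = (THE X. moore_penrose A X)"

definition mat_trace :: "'a::comm_monoid_add mat \<Rightarrow> 'a" where
  "mat_trace A = (\<Sum>i<dim_row A. A $$ (i, i))"

text \<open>An undirected edge is a pair of opposite arcs, so in a \<^const>\<open>pair_graph\<close> the degree of a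
  vertex is its out-degree. The list argument fixes the order of rows and columns.\<close>

definition laplacian_mat :: "'a pair_pre_digraph \<Rightarrow> 'a list \<Rightarrow> real mat" where
  "laplacian_mat G vs = mat (length vs) (length vs) (\<lambda>(i, j).
     if i = j then real (out_degree (with_proj G) (vs ! i))
     else if (vs ! i, vs ! j) \<in> parcs G then - 1 else 0)"

text \<open>Reordering the vertices conjugates the Laplacian, and hence its pseudo-inverse, by a
  permutation matrix; the trace below does not depend on the chosen enumeration.\<close>

definition vertex_enum :: "'a pair_pre_digraph \<Rightarrow> 'a list" where
  "vertex_enum G = (SOME vs. distinct vs \<and> set vs = pverts G)"

text \<open>The steady-state total variance of the deviation from the average in the consensus dynamics
  \<open>x' = - L x + \<nu>\<close> driven by unit white noise, taken in its closed form \<open>tr (L\<^sup>\<dagger>) / 2\<close>.\<close>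

definition coherence :: "'a pair_pre_digraph \<Rightarrow> real" where
  "coherence G = 1 / 2 * mat_trace (pseudo_inverse (laplacian_mat G (vertex_enum G)))"

definition path_graph :: "nat \<Rightarrow> (nat \<Rightarrow> 'a) \<Rightarrow> 'a pair_pre_digraph" where
  "path_graph n p = \<lparr> pverts = p ` {1..n},
     parcs = (\<Union>j\<in>{1..<n}. {(p j, p (j + 1)), (p (j + 1), p j)}) \<rparr>"

definition composite_graph ::
  "nat \<Rightarrow> (nat \<Rightarrow> 'a pair_pre_digraph) \<Rightarrow> 'a pair_pre_digraph \<Rightarrow> 'a pair_pre_digraph" where
  "composite_graph n G B = \<lparr> pverts = (\<Union>i\<in>{1..n}. pverts (G i)),
     parcs = (\<Union>i\<in>{1..n}. parcs (G i)) \<union> parcs B \<rparr>"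

end

theory Submission
  imports Defs "Jordan_Normal_Form.Determinant"
begin

text \<open>The idea is to separate the part of the coherence that depends on the ordering of the bridge
  nodes from the part that does not, and then to solve a rearrangement problem on the line.

  The trace of the pseudo-inverse of a Laplacian \<open>L\<close> with \<open>N\<close> vertices can be read off from any
  function \<open>Y\<close> of two vertices that solves \<open>L Y = I - g 1\<^sup>T\<close> for some vector \<open>g\<close>: it equals
  \<open>(\<Sum>v. Y v v) - (\<Sum>u v. Y u v) / N\<close> (\<open>trace_pseudo_inverse_kernel_mat\<close>). For a composite graph
  whose backbone is a path, such a solution is \<open>Y u v = K u v + min (pos u) (pos v)\<close>
  (\<open>composite_green\<close>). Here \<open>K\<close> is made of the Green's functions of the single graphs, each
  grounded at its bridge node, so that it is the same for all orderings, and \<open>pos u\<close> is the position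
  on the path of the bridge of the graph that contains \<open>u\<close>. Consequently the coherence is a constant
  plus a positive multiple of \<open>\<Sum>i j. m i * m j * \<bar>q i - q j\<bar>\<close>, where \<open>m i\<close> is the number of vertices of
  graph \<open>i\<close> and \<open>q i\<close> is its position (\<open>coherence_path_composite\<close>).

  Since the sizes \<open>m i\<close> decrease, summation by parts writes this weighted sum as a combination with
  nonnegative coefficients of the distances between the position sets of graphs \<open>1, \<dots>, k\<close> and
  \<open>1, \<dots>, l\<close>. For finite sets of integers of given cardinalities \<open>k\<close> and \<open>l\<close>, the total distance is
  least when both are intervals around the same centre (\<open>total_distance_ge_centred\<close>). The zigzag
  ordering places the first \<open>k\<close> graphs on such an interval for every \<open>k\<close> at once, hence minimises
  every term.\<close>

section \<open>Matrices indexed by vertices\<close>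

text \<open>A matrix indexed by an enumeration \<open>vs\<close> of a vertex set is a function of two vertices in
  disguise. Calculating with the function turns matrix products into sums over the vertex set and
  removes the enumeration from all the graph-theoretic arguments.\<close>

definition kernel_mat :: "'a list \<Rightarrow> ('a \<Rightarrow> 'a \<Rightarrow> real) \<Rightarrow> real mat" where
  "kernel_mat vs A = mat (length vs) (length vs) (\<lambda>(i, j). A (vs ! i) (vs ! j))"

lemma dim_kernel_mat [simp]:
  "dim_row (kernel_mat vs A) = length vs" "dim_col (kernel_mat vs A) = length vs"
  by (simp_all add: kernel_mat_def)

lemma kernel_mat_carrier [simp]: "kernel_mat vs A \<in> carrier_mat (length vs) (length vs)"
  by (simp add: kernel_mat_def)

lemma sum_nth_distinct:
  assumes "distinct vs"
  shows "(\<Sum>i<length vs. f (vs ! i)) = (\<Sum>v\<in>set vs. f v)"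
  by (rule sum.reindex_bij_betw) (rule bij_betw_nth, use assms in auto)

lemma kernel_mat_cong:
  assumes "\<And>u v. u \<in> set vs \<Longrightarrow> v \<in> set vs \<Longrightarrow> A u v = B u v"
  shows "kernel_mat vs A = kernel_mat vs B"
  using assms by (auto simp: kernel_mat_def)

lemma kernel_mat_mult:
  assumes "distinct vs"
  shows "kernel_mat vs A * kernel_mat vs B = kernel_mat vs (\<lambda>u v. \<Sum>w\<in>set vs. A u w * B w v)"
  by (rule eq_matI)
    (auto simp: kernel_mat_def scalar_prod_def lessThan_atLeast0[symmetric]
        sum_nth_distinct[OF assms, symmetric])

lemma transpose_kernel_mat: "transpose_mat (kernel_mat vs A) = kernel_mat vs (\<lambda>u v. A v u)"
  by (rule eq_matI) (auto simp: kernel_mat_def)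

lemma mat_trace_kernel_mat:
  assumes "distinct vs"
  shows "mat_trace (kernel_mat vs A) = (\<Sum>v\<in>set vs. A v v)"
  using sum_nth_distinct[OF assms, of "\<lambda>v. A v v"]
  by (simp add: mat_trace_def) (simp add: kernel_mat_def)

text \<open>The invertibility criterion for square matrices, carried over to functions on a vertex set, where
  its hypothesis can be checked by an energy argument.\<close>

lemma kernel_right_inverse_exists:
  fixes A :: "'a \<Rightarrow> 'a \<Rightarrow> real"
  assumes fin: "finite V"
    and inj: "\<And>f. (\<And>u. u \<in> V \<Longrightarrow> (\<Sum>w\<in>V. A u w * f w) = 0) \<Longrightarrow> \<forall>u\<in>V. f u = 0"
  shows "\<exists>Z. \<forall>u\<in>V. \<forall>v\<in>V. (\<Sum>w\<in>V. A u w * Z w v) = of_bool (u = v)"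
proof -
  obtain vs where vs: "set vs = V" "distinct vs"
    using finite_distinct_list[OF fin] by blast
  let ?n = "length vs" and ?M = "kernel_mat vs A"
  have bij: "bij_betw (nth vs) {..<?n} V"
    using bij_betw_nth[OF vs(2) refl] vs(1) by blast
  define idx where "idx = inv_into {..<?n} (nth vs)"
  have idx: "idx (vs ! i) = i" if "i < ?n" for i
    using bij that unfolding idx_def bij_betw_def by (simp add: inv_into_f_f)
  have idxV: "idx v < ?n" "vs ! idx v = v" if "v \<in> V" for v
    using bij that unfolding idx_def bij_betw_def
    by (metis inv_into_into lessThan_iff, metis f_inv_into_f)
  have "det ?M \<noteq> 0"
  proof
    assume "det ?M = 0"
    then obtain x where x: "x \<in> carrier_vec ?n" "x \<noteq> 0\<^sub>v ?n" "?M *\<^sub>v x = 0\<^sub>v ?n"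
      using det_0_iff_vec_prod_zero_field[OF kernel_mat_carrier] by blast
    have "(\<Sum>w\<in>V. A u w * (x $ idx w)) = 0" if u: "u \<in> V" for u
    proof -
      have "(\<Sum>w\<in>V. A u w * (x $ idx w)) = (\<Sum>i<?n. A u (vs ! i) * (x $ idx (vs ! i)))"
        by (simp only: sum_nth_distinct[OF vs(2), of "\<lambda>w. A u w * (x $ idx w)"] vs(1))
      also have "\<dots> = (\<Sum>i<?n. A u (vs ! i) * (x $ i))"
        by (simp add: idx)
      also have "\<dots> = (?M *\<^sub>v x) $ idx u"
        using idxV[OF u] x(1)
        by (simp add: kernel_mat_def scalar_prod_def lessThan_atLeast0)
      also have "\<dots> = 0"
        using idxV[OF u] x(3) by simp
      finally show ?thesis .
    qed
    from inj[OF this] have "x $ i = 0" if "i < ?n" for i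
      using that idx vs(1) nth_mem by metis
    then have "x = 0\<^sub>v ?n"
      using x(1) by (intro eq_vecI) auto
    with x(2) show False by blast
  qed
  from det_non_zero_imp_unit[OF kernel_mat_carrier this, of ?n]
  obtain X where X: "X \<in> carrier_mat ?n ?n" "?M * X = 1\<^sub>m ?n"
    by (auto simp: Units_def ring_mat_def)
  let ?Z = "\<lambda>u v. X $$ (idx u, idx v)"
  have "X = kernel_mat vs ?Z"
    using X(1) by (intro eq_matI) (auto simp: kernel_mat_def idx)
  then have prod: "kernel_mat vs (\<lambda>u v. \<Sum>w\<in>V. A u w * ?Z w v) = 1\<^sub>m ?n"
    using X(2) kernel_mat_mult[OF vs(2), of A ?Z] vs(1) by simp
  have "(\<Sum>w\<in>V. A u w * ?Z w v) = of_bool (u = v)" if "u \<in> V" "v \<in> V" for u v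
  proof -
    have "(\<Sum>w\<in>V. A u w * ?Z w v)
        = kernel_mat vs (\<lambda>u v. \<Sum>w\<in>V. A u w * ?Z w v) $$ (idx u, idx v)"
      using idxV[OF that(1)] idxV[OF that(2)] by (simp add: kernel_mat_def)
    also have "\<dots> = of_bool (idx u = idx v)"
      using idxV[OF that(1)] idxV[OF that(2)] by (simp add: prod)
    also have "(idx u = idx v) = (u = v)"
      using idxV[OF that(1)] idxV[OF that(2)] by metis
    finally show ?thesis .
  qed
  then show ?thesis by (intro exI[of _ ?Z] ballI)
qed

section \<open>The trace of the pseudo-inverse from a Green's function\<close>

text \<open>Penrose's argument: \<open>A X\<close> and \<open>A Y\<close> are two orthogonal projections onto the range of \<open>A\<close>, hence
  equal; likewise \<open>X A = Y A\<close>; and \<open>X = X A X = Y A Y = Y\<close>.\<close>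

lemma moore_penrose_unique:
  assumes X: "moore_penrose A X" and Y: "moore_penrose A Y"
  shows "X = Y"
proof -
  define n m where "n = dim_row A" and "m = dim_col A"
  have cA: "A \<in> carrier_mat n m" by (auto simp: n_def m_def)
  have cX: "X \<in> carrier_mat m n" and cY: "Y \<in> carrier_mat m n"
    using X Y by (auto simp: moore_penrose_def n_def m_def)
  note X' = X[unfolded moore_penrose_def] and Y' = Y[unfolded moore_penrose_def]
  have AX: "A * X \<in> carrier_mat n n" and AY: "A * Y \<in> carrier_mat n n"
    and XA: "X * A \<in> carrier_mat m m" and YA: "Y * A \<in> carrier_mat m m"
    using cA cX cY by auto
  have "A * X = transpose_mat ((A * Y) * (A * X))"
    using X' Y' assoc_mult_mat[OF AY cA cX] by simp
  also have "\<dots> = (A * X) * (A * Y)"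
    using transpose_mult[OF AY AX] X' Y' by simp
  also have "\<dots> = A * Y"
    using assoc_mult_mat[OF AX cA cY] X' by simp
  finally have 1: "A * X = A * Y" .
  have "X * A = transpose_mat ((X * A) * (Y * A))"
    using X' Y' assoc_mult_mat[OF cX cA YA] assoc_mult_mat[OF cA cY cA] by simp
  also have "\<dots> = (Y * A) * (X * A)"
    using transpose_mult[OF XA YA] X' Y' by simp
  also have "\<dots> = Y * A"
    using assoc_mult_mat[OF cY cA XA] assoc_mult_mat[OF cA cX cA] X' by simp
  finally have 2: "X * A = Y * A" .
  have "X = (X * A) * X" using X' by simp
  also have "\<dots> = Y * (A * X)"
    using 2 assoc_mult_mat[OF cY cA cX] by simp
  also have "\<dots> = Y"
    using 1 Y' assoc_mult_mat[OF cY cA cY] by simp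
  finally show ?thesis .
qed

lemma pseudo_inverse_eqI:
  assumes "moore_penrose A X"
  shows "pseudo_inverse A = X"
  unfolding pseudo_inverse_def using assms moore_penrose_unique by blast

text \<open>This reduces the trace of the pseudo-inverse to any solution \<open>Y\<close> of the Poisson
  equation, up to an error \<open>g\<close> that is the same in all columns (in the use below
  \<open>g\<close> is the indicator of a root vertex, where the current leaves the network). With \<open>J\<close> the all-ones matrix and
  \<open>P = I - J/N\<close>, the doubly centred matrix \<open>X = P Y P\<close> satisfies \<open>L X = P\<close>, because \<open>L P = L\<close>
  and the factor \<open>P\<close> on the right removes \<open>g 1\<^sup>T\<close>. All four Penrose equations follow from \<open>L X = P\<close>,
  the symmetry and zero row sums of \<open>L\<close>, and the zero column sums of \<open>X\<close>.\<close>

lemma trace_pseudo_inverse_kernel_mat: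
  fixes L Y :: "'a \<Rightarrow> 'a \<Rightarrow> real"
  assumes vs: "distinct vs" "vs \<noteq> []"
    and sym: "\<And>u v. u \<in> set vs \<Longrightarrow> v \<in> set vs \<Longrightarrow> L u v = L v u"
    and row: "\<And>u. u \<in> set vs \<Longrightarrow> (\<Sum>v\<in>set vs. L u v) = 0"
    and green: "\<And>u v. u \<in> set vs \<Longrightarrow> v \<in> set vs \<Longrightarrow>
                  (\<Sum>w\<in>set vs. L u w * Y w v) = of_bool (u = v) - g u"
  shows "mat_trace (pseudo_inverse (kernel_mat vs L))
       = (\<Sum>v\<in>set vs. Y v v) - (\<Sum>u\<in>set vs. \<Sum>v\<in>set vs. Y u v) / card (set vs)"
proof -
  define V N where "V = set vs" and "N = real (card V)"
  have fin: "finite V" and N: "N > 0"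
    using vs(2) by (auto simp: V_def N_def card_gt_0_iff)
  define P where "P = (\<lambda>u v::'a. of_bool (u = v) - 1 / N)"
  \<comment> \<open>\<open>X\<close> is \<open>P Y P\<close> written out: \<open>r\<close> holds the row means, \<open>k\<close> the column means of the rest.\<close>
  define r where "r u = (\<Sum>z\<in>V. Y u z) / N" for u
  define k where "k v = (\<Sum>z\<in>V. Y z v) / N - (\<Sum>z\<in>V. r z) / N" for v
  define X where "X u v = Y u v - r u - k v" for u v
  note sym = sym[folded V_def] and row = row[folded V_def] and green = green[folded V_def]
  have N_sum: "real (card V) = N" by (simp add: N_def)
  have sum_k: "(\<Sum>v\<in>V. k v) = 0"
  proof -
    have "(\<Sum>v\<in>V. \<Sum>z\<in>V. Y z v) = N * (\<Sum>z\<in>V. r z)"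
      using N by (subst sum.swap) (simp add: r_def sum_divide_distrib[symmetric])
    then show ?thesis
      using N by (simp add: k_def sum_subtractf sum_divide_distrib[symmetric] N_sum)
  qed
  have col_X: "(\<Sum>u\<in>V. X u v) = 0" for v
    using N by (simp add: X_def sum_subtractf N_sum) (simp add: k_def field_simps)
  have LX: "(\<Sum>w\<in>V. L u w * X w v) = P u v" if "u \<in> V" "v \<in> V" for u v
  proof -
    have "(\<Sum>w\<in>V. L u w * r w) = (\<Sum>w\<in>V. \<Sum>z\<in>V. L u w * Y w z) / N"
      by (simp add: r_def sum_distrib_left sum_divide_distrib)
    also have "(\<Sum>w\<in>V. \<Sum>z\<in>V. L u w * Y w z) = (\<Sum>z\<in>V. of_bool (u = z) - g u)"
      using green that by (subst sum.swap) simp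
    also have "\<dots> = 1 - N * g u"
      using fin that by (simp add: sum_subtractf N_sum of_bool_def)
    finally have Lr: "(\<Sum>w\<in>V. L u w * r w) = 1 / N - g u"
      using N by (simp add: field_simps)
    have "(\<Sum>w\<in>V. L u w * X w v)
        = (\<Sum>w\<in>V. L u w * Y w v) - (\<Sum>w\<in>V. L u w * r w) - (\<Sum>w\<in>V. L u w) * k v"
      by (simp add: X_def algebra_simps sum_subtractf sum.distrib sum_distrib_left sum_distrib_right)
    then show ?thesis using green row Lr that by (simp add: P_def)
  qed
  \<comment> \<open>\<open>P\<close> is the orthogonal projection onto the functions of sum zero.\<close>
  have P_mult: "(\<Sum>w\<in>V. P u w * f w) = f u" if "u \<in> V" "(\<Sum>w\<in>V. f w) = 0" for u f
  proof -
    have "(\<Sum>w\<in>V. P u w * f w) = (\<Sum>w\<in>V. of_bool (u = w) * f w) - (\<Sum>w\<in>V. f w) / N"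
      by (simp add: P_def algebra_simps sum_subtractf sum_divide_distrib)
    also have "(\<Sum>w\<in>V. of_bool (u = w) * f w) = f u"
      using fin that(1) by (simp add: of_bool_def if_distrib[where f="\<lambda>x. x * _"] cong: if_cong)
    finally show ?thesis using that(2) by simp
  qed
  have P_sym: "P u v = P v u" for u v by (simp add: P_def eq_commute)
  \<comment> \<open>Evaluate \<open>X\<^sup>T L X\<close> in two ways: it is \<open>X\<^sup>T P = X\<^sup>T\<close> and also \<open>P X = X\<close>.\<close>
  have sym_X: "X u v = X v u" if uv: "u \<in> V" "v \<in> V" for u v
  proof -
    have "X v u = (\<Sum>w\<in>V. P v w * X w u)" using P_mult uv col_X by simp
    also have "\<dots> = (\<Sum>w\<in>V. X w u * (\<Sum>z\<in>V. L w z * X z v))"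
      using LX uv by (intro sum.cong) (simp_all add: P_sym[of v])
    also have "\<dots> = (\<Sum>z\<in>V. (\<Sum>w\<in>V. L z w * X w u) * X z v)"
      unfolding sum_distrib_left sum_distrib_right
      by (subst sum.swap) (intro sum.cong, auto simp: sym)
    also have "\<dots> = (\<Sum>z\<in>V. P u z * X z v)"
      using LX uv by (intro sum.cong) (simp_all add: P_sym[of u])
    also have "\<dots> = X u v" using P_mult uv col_X by simp
    finally show ?thesis by simp
  qed
  have mLX: "kernel_mat vs L * kernel_mat vs X = kernel_mat vs P"
    unfolding kernel_mat_mult[OF vs(1)] using LX by (intro kernel_mat_cong) (simp add: V_def)
  have mXL: "kernel_mat vs X * kernel_mat vs L = kernel_mat vs P"
    unfolding kernel_mat_mult[OF vs(1)]
  proof (rule kernel_mat_cong, fold V_def)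
    fix u v assume uv: "u \<in> V" "v \<in> V"
    have "(\<Sum>w\<in>V. X u w * L w v) = (\<Sum>w\<in>V. L v w * X w u)"
      using uv sym sym_X by (intro sum.cong) auto
    then show "(\<Sum>w\<in>V. X u w * L w v) = P u v" using LX uv P_sym by simp
  qed
  have "(\<Sum>w\<in>V. L w v) = 0" if "v \<in> V" for v
    using row[OF that] sym that by (metis (no_types, lifting) sum.cong)
  then have mPL: "kernel_mat vs P * kernel_mat vs L = kernel_mat vs L"
    unfolding kernel_mat_mult[OF vs(1)] using P_mult by (intro kernel_mat_cong) (simp add: V_def)
  have mPX: "kernel_mat vs P * kernel_mat vs X = kernel_mat vs X"
    unfolding kernel_mat_mult[OF vs(1)] using P_mult col_X
    by (intro kernel_mat_cong) (simp add: V_def)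
  have "transpose_mat (kernel_mat vs P) = kernel_mat vs P"
    unfolding transpose_kernel_mat by (intro kernel_mat_cong) (rule P_sym)
  then have "moore_penrose (kernel_mat vs L) (kernel_mat vs X)"
    by (simp add: moore_penrose_def mLX mXL mPL mPX)
  then have "mat_trace (pseudo_inverse (kernel_mat vs L)) = (\<Sum>v\<in>V. X v v)"
    by (simp add: pseudo_inverse_eqI mat_trace_kernel_mat[OF vs(1)] V_def)
  also have "\<dots> = (\<Sum>v\<in>V. Y v v) - (\<Sum>u\<in>V. r u)"
    by (simp add: X_def sum_subtractf sum_k)
  finally show ?thesis
    by (simp add: r_def sum_divide_distrib[symmetric] V_def N_def)
qed

section \<open>Laplacians, Dirichlet energy and the path\<close>

text \<open>The Laplacian as a function of two vertices depends only on the arc set. It acts by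
  \<open>f \<mapsto> (\<lambda>u. \<Sum>w\<in>E `` {u}. f u - f w)\<close> (\<open>sum_lap\<close>), a form that splits along disjoint unions of arc sets.\<close>

definition lap :: "('a \<times> 'a) set \<Rightarrow> 'a \<Rightarrow> 'a \<Rightarrow> real" where
  "lap E u v = (if u = v then real (card (E `` {u})) else if (u, v) \<in> E then - 1 else 0)"

lemma laplacian_mat_eq_kernel_mat:
  assumes "distinct vs"
  shows "laplacian_mat H vs = kernel_mat vs (lap (parcs H))"
proof -
  have "out_degree (with_proj H) u = card (parcs H `` {u})" for u
  proof -
    have "out_arcs (with_proj H) u = Pair u ` (parcs H `` {u})"
      by (auto simp: out_arcs_def)
    then show ?thesis by (simp add: out_degree_def card_image inj_on_def)
  qed
  then show ?thesis
    using assms by (intro eq_matI)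
      (auto simp: laplacian_mat_def kernel_mat_def lap_def nth_eq_iff_index_eq)
qed

lemma lap_symmetric: "sym E \<Longrightarrow> lap E u v = lap E v u"
  by (auto simp: lap_def dest: symD)

lemma sum_lap:
  assumes "finite V" "E \<subseteq> V \<times> V" "irrefl E" "u \<in> V"
  shows "(\<Sum>w\<in>V. lap E u w * f w) = (\<Sum>w\<in>E `` {u}. f u - f w)"
proof -
  have sub: "E `` {u} \<subseteq> V" using assms(2) by auto
  have "(\<Sum>w\<in>V. lap E u w * f w)
      = (\<Sum>w\<in>V. of_bool (w = u) * (real (card (E `` {u})) * f w)) - (\<Sum>w\<in>V. of_bool (w \<in> E `` {u}) * f w)"
    using assms(3) unfolding sum_subtractf[symmetric]
    by (intro sum.cong) (auto simp: lap_def irrefl_def)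
  also have "(\<Sum>w\<in>V. of_bool (w = u) * (real (card (E `` {u})) * f w)) = (\<Sum>w\<in>{u}. real (card (E `` {u})) * f w)"
    using assms(1,4) by (intro sum.mono_neutral_cong_right) auto
  also have "(\<Sum>w\<in>V. of_bool (w \<in> E `` {u}) * f w) = (\<Sum>w\<in>E `` {u}. f w)"
    using assms(1) sub by (intro sum.mono_neutral_cong_right) auto
  finally show ?thesis by (simp add: sum_subtractf)
qed

text \<open>Summation by parts: each undirected edge occurs as two arcs, whose contributions
  \<open>f u * (f u - f w)\<close> and \<open>f w * (f w - f u)\<close> add up to a square.\<close>

lemma dirichlet_energy:
  fixes f :: "'a \<Rightarrow> real"
  assumes "finite V" "E \<subseteq> V \<times> V" "sym E"
  shows "(\<Sum>u\<in>V. f u * (\<Sum>w\<in>E `` {u}. f u - f w)) = (\<Sum>(u, w)\<in>E. (f u - f w)\<^sup>2) / 2"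
proof -
  have finE: "finite E" using assms(1,2) by (meson finite_SigmaI finite_subset)
  have "(\<Sum>u\<in>V. f u * (\<Sum>w\<in>E `` {u}. f u - f w)) = (\<Sum>(u, w)\<in>Sigma V (\<lambda>u. E `` {u}). f u * (f u - f w))"
    using assms(1) finE by (simp add: sum_distrib_left sum.Sigma finite_Image)
  also have "Sigma V (\<lambda>u. E `` {u}) = E" using assms(2) by auto
  finally have 1: "(\<Sum>u\<in>V. f u * (\<Sum>w\<in>E `` {u}. f u - f w)) = (\<Sum>(u, w)\<in>E. f u * (f u - f w))" .
  have "(\<Sum>(u, w)\<in>E. f u * (f u - f w)) = (\<Sum>(u, w)\<in>E. f w * (f w - f u))"
    using assms(3) by (intro sum.reindex_bij_witness[of _ prod.swap prod.swap]) (auto dest: symD)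
  then have "2 * (\<Sum>(u, w)\<in>E. f u * (f u - f w)) = (\<Sum>(u, w)\<in>E. f u * (f u - f w) + f w * (f w - f u))"
    by (simp add: sum.distrib case_prod_unfold)
  also have "\<dots> = (\<Sum>(u, w)\<in>E. (f u - f w)\<^sup>2)"
    by (intro sum.cong) (auto simp: power2_eq_square algebra_simps)
  finally show ?thesis using 1 by simp
qed

lemma connected_imp_constant:
  fixes H :: "'a pair_pre_digraph"
  assumes conn: "Digraph_Component.connected (with_proj H)"
    and arcs: "\<And>u w. (u, w) \<in> parcs H \<Longrightarrow> f u = f w"
    and uv: "u \<in> pverts H" "v \<in> pverts H"
  shows "f u = f v"
proof -
  have "(u, v) \<in> rtrancl_on (pverts H) (parcs (mk_symmetric (with_proj H)))"
    using conn uv by (simp add: connected_def strongly_connected_def reachable_def)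
  then show ?thesis
    by (induction rule: rtrancl_on_induct) (auto simp: parcs_mk_symmetric dest: arcs)
qed

lemma path_graph_neighbours:
  assumes inj: "inj_on p {1..n}" and a: "a \<in> {1..n}"
  shows "parcs (path_graph n p) `` {p a} = p ` ({a - 1, a + 1} \<inter> {1..n})"
proof -
  have inj': "p i = p j \<longleftrightarrow> i = j" if "i \<in> {1..n}" "j \<in> {1..n}" for i j
    using inj_on_eq_iff[OF inj that] .
  show ?thesis
  proof (intro equalityI subsetI)
    fix w assume "w \<in> parcs (path_graph n p) `` {p a}"
    then obtain j where j: "j \<in> {1..<n}" "p a = p j \<and> w = p (j + 1) \<or> p a = p (j + 1) \<and> w = p j"
      by (auto simp: path_graph_def)
    then have "a = j \<and> w = p (j + 1) \<or> a = j + 1 \<and> w = p j"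
      using inj'[OF a, of j] inj'[OF a, of "j + 1"] by auto
    then show "w \<in> p ` ({a - 1, a + 1} \<inter> {1..n})" using j(1) by auto
  next
    fix w assume "w \<in> p ` ({a - 1, a + 1} \<inter> {1..n})"
    then obtain b where b: "w = p b" "b = a - 1 \<or> b = a + 1" "b \<in> {1..n}" by auto
    from b(2) show "w \<in> parcs (path_graph n p) `` {p a}"
    proof
      assume "b = a - 1"
      then have "a = b + 1" "b \<in> {1..<n}" using a b(3) by auto
      then show ?thesis using b(1) by (auto simp: path_graph_def)
    next
      assume "b = a + 1"
      then have "a \<in> {1..<n}" using a b(3) by auto
      then show ?thesis using b(1) \<open>b = a + 1\<close> by (auto simp: path_graph_def)
    qed
  qed
qed

text \<open>On the path \<open>1, \<dots>, n\<close> the function \<open>min\<close> is, up to an additive constant, the Green's function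
  grounded at the left end: \<open>b \<mapsto> min b c\<close> is linear except for the kink at \<open>c\<close>, where the unit
  source sits, and the sink is at vertex \<open>1\<close>. The missing neighbour of \<open>n\<close>
  would contribute nothing, since \<open>min b c = c\<close> for \<open>b \<ge> c\<close>; the missing neighbour of \<open>1\<close> would
  contribute the \<open>1\<close> that appears as the sink.\<close>

lemma path_green:
  assumes "a \<in> {1..n}" "c \<in> {1..n}"
  shows "(\<Sum>b\<in>{a - 1, a + 1} \<inter> {1..n}. real (min a c) - real (min b c))
       = of_bool (a = c) - of_bool (a = 1)"
proof -
  let ?g = "\<lambda>b. real (min a c) - real (min b c)"
  have "{a - 1, a + 1} \<inter> {1..n} = (if a = 1 then {} else {a - 1}) \<union> (if a = n then {} else {a + 1})"
    using assms by auto
  then have "(\<Sum>b\<in>{a - 1, a + 1} \<inter> {1..n}. ?g b)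
      = (if a = 1 then 0 else ?g (a - 1)) + (if a = n then 0 else ?g (a + 1))"
    by auto
  then show ?thesis using assms by (auto simp: min_def of_nat_diff)
qed

section \<open>Green's functions of composite graphs\<close>

text \<open>The given graphs and bridge nodes, before a backbone is chosen. Everything in
  this context that does not mention an ordering \<open>t\<close> is therefore the same for all backbones.\<close>

locale bridged_graphs =
  fixes n :: nat
    and G :: "nat \<Rightarrow> 'a pair_pre_digraph"
    and l :: "nat \<Rightarrow> 'a"
  assumes graphs: "\<And>i. i \<in> {1..n} \<Longrightarrow> pair_graph (G i)"
    and conn: "\<And>i. i \<in> {1..n} \<Longrightarrow> Digraph_Component.connected (with_proj (G i))"
    and disj: "\<And>i j. i \<in> {1..n} \<Longrightarrow> j \<in> {1..n} \<Longrightarrow> i \<noteq> j \<Longrightarrow>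
                 pverts (G i) \<inter> pverts (G j) = {}"
    and bridge: "\<And>i. i \<in> {1..n} \<Longrightarrow> l i \<in> pverts (G i)"
begin

definition V :: "'a set" where "V = (\<Union>i\<in>{1..n}. pverts (G i))"

definition E :: "('a \<times> 'a) set" where "E = (\<Union>i\<in>{1..n}. parcs (G i))"

definition block :: "'a \<Rightarrow> nat" where "block u = (THE i. i \<in> {1..n} \<and> u \<in> pverts (G i))"

lemma block_eq:
  assumes "i \<in> {1..n}" "u \<in> pverts (G i)"
  shows "block u = i"
  unfolding block_def
proof (rule the_equality)
  show "i \<in> {1..n} \<and> u \<in> pverts (G i)" using assms by blast
  show "j = i" if "j \<in> {1..n} \<and> u \<in> pverts (G j)" for j
    using that assms disj[of j i] by blast
qed

lemma block_in:
  assumes "u \<in> V"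
  shows "block u \<in> {1..n}" "u \<in> pverts (G (block u))"
proof -
  obtain i where i: "i \<in> {1..n}" "u \<in> pverts (G i)" using assms by (auto simp: V_def)
  show "block u \<in> {1..n}" "u \<in> pverts (G (block u))"
    using i by (simp_all only: block_eq[OF i])
qed

lemma finite_block:
  assumes "i \<in> {1..n}"
  shows "finite (pverts (G i))"
proof -
  interpret pair_graph "G i" using assms by (rule graphs)
  show ?thesis by (rule pair_finite_verts)
qed

lemma finite_V: "finite V"
  using finite_block by (auto simp: V_def)

lemma arc_in:
  assumes "i \<in> {1..n}" "(u, w) \<in> parcs (G i)"
  shows "u \<in> pverts (G i)" "w \<in> pverts (G i)" "u \<noteq> w" "(w, u) \<in> parcs (G i)"
proof -
  interpret pair_graph "G i" using assms(1) by (rule graphs)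
  show "u \<in> pverts (G i)" "w \<in> pverts (G i)" using assms(2) in_arcsD1 in_arcsD2 by auto
  show "u \<noteq> w" using assms(2) pair_no_loops by force
  show "(w, u) \<in> parcs (G i)" using assms(2) pair_sym_arcs by (auto simp: symmetric_def dest: symD)
qed

lemma E_in:
  assumes "(u, w) \<in> E"
  shows "u \<in> V" "w \<in> V" "block u = block w" "u \<noteq> w"
proof -
  obtain i where i: "i \<in> {1..n}" "(u, w) \<in> parcs (G i)" using assms by (auto simp: E_def)
  note arc = arc_in[OF i]
  show "u \<in> V" "w \<in> V" using i(1) arc by (auto simp: V_def)
  show "block u = block w" using block_eq[OF i(1)] arc by simp
  show "u \<noteq> w" by (rule arc(3))
qed

lemma E_subset: "E \<subseteq> V \<times> V"
  using E_in by auto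

lemma irrefl_E: "irrefl E"
  using E_in(4) by (auto simp: irrefl_def)

lemma sym_E: "sym E"
proof (rule symI)
  fix u w assume "(u, w) \<in> E"
  then obtain i where "i \<in> {1..n}" "(u, w) \<in> parcs (G i)" by (auto simp: E_def)
  then show "(w, u) \<in> E" unfolding E_def using arc_in(4) by blast
qed

lemma bridge_in:
  assumes "i \<in> {1..n}"
  shows "l i \<in> V" "block (l i) = i"
  using assms bridge[OF assms] block_eq[OF assms] unfolding V_def by blast+

lemma bridges_subset: "l ` {1..n} \<subseteq> V"
  using bridge_in(1) by (rule image_subsetI)

lemma inj_on_bridge: "inj_on l {1..n}"
  using bridge_in(2) by (rule inj_on_inverseI)

lemma sum_over_blocks:
  fixes F :: "nat \<Rightarrow> real"
  shows "(\<Sum>u\<in>V. F (block u)) = (\<Sum>i=1..n. card (pverts (G i)) * F i)"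
proof -
  have "(\<Sum>u\<in>V. F (block u)) = (\<Sum>i=1..n. \<Sum>u\<in>pverts (G i). F (block u))"
    unfolding V_def using finite_block disj by (intro sum.UNION_disjoint) simp_all
  also have "\<dots> = (\<Sum>i=1..n. \<Sum>u\<in>pverts (G i). F i)"
    using block_eq by (intro sum.cong refl) auto
  finally show ?thesis by simp
qed

text \<open>The Laplacian of the disjoint union of the graphs has one null vector per graph. Adding \<open>1\<close> to
  the diagonal at each bridge node, as if each bridge were tied to the ground, removes them.\<close>

definition grounded_lap :: "'a \<Rightarrow> 'a \<Rightarrow> real" where
  "grounded_lap u w = lap E u w + of_bool (u = w \<and> u \<in> l ` {1..n})"

lemma sum_grounded_lap:
  assumes "u \<in> V"
  shows "(\<Sum>w\<in>V. grounded_lap u w * f w)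
       = (\<Sum>w\<in>E `` {u}. f u - f w) + of_bool (u \<in> l ` {1..n}) * f u"
proof -
  have "(\<Sum>w\<in>V. of_bool (u = w \<and> u \<in> l ` {1..n}) * f w) = (\<Sum>w\<in>{u}. of_bool (u \<in> l ` {1..n}) * f w)"
    using assms finite_V by (intro sum.mono_neutral_cong_right) auto
  then show ?thesis
    using sum_lap[OF finite_V E_subset irrefl_E assms, of f]
    by (simp add: grounded_lap_def distrib_right sum.distrib)
qed

text \<open>If the grounded Laplacian annihilates \<open>f\<close>, its quadratic form at \<open>f\<close> vanishes. That form is the
  Dirichlet energy plus the squares of \<open>f\<close> at the bridges, so \<open>f\<close> is constant on every graph and
  zero at its bridge.\<close>

lemma grounded_lap_injective:
  assumes ker: "\<And>u. u \<in> V \<Longrightarrow> (\<Sum>w\<in>V. grounded_lap u w * f w) = 0"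
  shows "\<forall>u\<in>V. f u = 0"
proof -
  let ?energy = "\<Sum>(u, w)\<in>E. (f u - f w)\<^sup>2" and ?b = "\<lambda>u. of_bool (u \<in> l ` {1..n}) * (f u)\<^sup>2"
  have finE: "finite E" using finite_V E_subset by (meson finite_SigmaI finite_subset)
  have "0 = (\<Sum>u\<in>V. f u * (\<Sum>w\<in>V. grounded_lap u w * f w))" using ker by simp
  also have "\<dots> = (\<Sum>u\<in>V. f u * (\<Sum>w\<in>E `` {u}. f u - f w) + ?b u)"
    by (intro sum.cong refl, subst sum_grounded_lap) (auto simp: algebra_simps power2_eq_square)
  also have "\<dots> = ?energy / 2 + (\<Sum>u\<in>V. ?b u)"
    by (simp add: sum.distrib dirichlet_energy[OF finite_V E_subset sym_E])
  finally have total: "?energy / 2 + (\<Sum>u\<in>V. ?b u) = 0" by simp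
  have e0: "0 \<le> ?energy" and b0: "0 \<le> (\<Sum>u\<in>V. ?b u)"
    by (auto intro!: sum_nonneg)
  have "?energy = 0" "(\<Sum>u\<in>V. ?b u) = 0"
    using total e0 b0 by linarith+
  have arc: "f u = f w" if "(u, w) \<in> E" for u w
  proof -
    have "\<forall>e\<in>E. (case e of (u, w) \<Rightarrow> (f u - f w)\<^sup>2) = 0"
      using \<open>?energy = 0\<close> finE by (subst (asm) sum_nonneg_eq_0_iff) auto
    then show ?thesis using that by fastforce
  qed
  have bridge0: "?b u = 0" if "u \<in> V" for u
    using \<open>(\<Sum>u\<in>V. ?b u) = 0\<close> finite_V that by (subst (asm) sum_nonneg_eq_0_iff) simp_all
  show ?thesis
  proof
    fix u assume u: "u \<in> V"
    note i = block_in[OF u]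
    have "f u = f (l (block u))"
    proof (rule connected_imp_constant[OF conn[OF i(1)] _ i(2) bridge[OF i(1)]])
      show "f x = f y" if "(x, y) \<in> parcs (G (block u))" for x y
        using that i(1) by (intro arc) (auto simp: E_def)
    qed
    also have "\<dots> = 0"
      using bridge0[of "l (block u)"] bridge_in i(1) by simp
    finally show "f u = 0" .
  qed
qed

text \<open>\<open>K\<close> collects the Green's functions of the separate graphs, each grounded at its own bridge.
  The first property makes \<open>K\<close> invisible to the backbone: all its arcs join bridges, where \<open>K\<close>
  is zero.

  Let \<open>Z\<close> be the inverse of the grounded Laplacian. The indicator of a graph is mapped by the
  grounded Laplacian to the indicator of its bridge, so by symmetry the bridge row of \<open>Z\<close> is the
  indicator of the graph. Subtracting the indicator of two vertices being in the same graph
  makes that row zero and preserves the Laplacian of each column, since this indicator is constant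
  along the arcs.\<close>

lemma block_green_exists:
  obtains K :: "'a \<Rightarrow> 'a \<Rightarrow> real" where
    "\<And>i v. i \<in> {1..n} \<Longrightarrow> v \<in> V \<Longrightarrow> K (l i) v = 0"
    "\<And>u v. u \<in> V \<Longrightarrow> v \<in> V \<Longrightarrow>
       (\<Sum>w\<in>E `` {u}. K u v - K w v) = of_bool (u = v) - of_bool (u = l (block v))"
proof -
  obtain Z where Z: "\<And>u v. u \<in> V \<Longrightarrow> v \<in> V \<Longrightarrow> (\<Sum>w\<in>V. grounded_lap u w * Z w v) = of_bool (u = v)"
    using kernel_right_inverse_exists[of V grounded_lap, OF finite_V grounded_lap_injective] by metis
  have Z_bridge: "Z (l i) v = of_bool (block v = i)" if i: "i \<in> {1..n}" and v: "v \<in> V" for i v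
  proof -
    define h :: "'a \<Rightarrow> real" where "h u = of_bool (block u = i)" for u
    have Mh: "(\<Sum>u\<in>V. h u * grounded_lap u w) = of_bool (w = l i)" if "w \<in> V" for w
    proof -
      have "(\<Sum>u\<in>V. h u * grounded_lap u w) = (\<Sum>u\<in>V. grounded_lap w u * h u)"
        by (intro sum.cong refl) (auto simp: grounded_lap_def lap_symmetric[OF sym_E])
      also have "\<dots> = (\<Sum>u\<in>E `` {w}. h w - h u) + of_bool (w \<in> l ` {1..n}) * h w"
        by (rule sum_grounded_lap[OF that])
      also have "(\<Sum>u\<in>E `` {w}. h w - h u) = 0"
        using E_in(3) by (intro sum.neutral) (auto simp: h_def)
      also have "of_bool (w \<in> l ` {1..n}) * h w = (of_bool (w = l i) :: real)"
        using i bridge_in(2) by (auto simp: h_def)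
      finally show ?thesis by simp
    qed
    have "h v = (\<Sum>u\<in>V. h u * of_bool (u = v))"
      using finite_V v by (simp add: of_bool_def if_distrib cong: if_cong)
    also have "\<dots> = (\<Sum>u\<in>V. h u * (\<Sum>w\<in>V. grounded_lap u w * Z w v))"
      using Z v by (intro sum.cong) auto
    also have "\<dots> = (\<Sum>w\<in>V. (\<Sum>u\<in>V. h u * grounded_lap u w) * Z w v)"
      unfolding sum_distrib_left sum_distrib_right by (subst sum.swap) (simp add: mult.assoc)
    also have "\<dots> = (\<Sum>w\<in>V. of_bool (w = l i) * Z w v)"
      using Mh by (intro sum.cong) auto
    also have "\<dots> = (\<Sum>w\<in>{l i}. Z w v)"
      using finite_V bridge_in(1)[OF i] by (intro sum.mono_neutral_cong_right) auto
    finally show ?thesis by (simp add: h_def)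
  qed
  show thesis
  proof (rule that[of "\<lambda>u v. Z u v - of_bool (block u = block v)"])
    show "Z (l i) v - of_bool (block (l i) = block v) = 0" if "i \<in> {1..n}" "v \<in> V" for i v
      using Z_bridge[OF that] bridge_in(2)[OF that(1)] by auto
    fix u v assume uv: "u \<in> V" "v \<in> V"
    have "(\<Sum>w\<in>E `` {u}. (Z u v - of_bool (block u = block v)) - (Z w v - of_bool (block w = block v)))
        = (\<Sum>w\<in>E `` {u}. Z u v - Z w v)"
      using E_in(3) by (intro sum.cong) auto
    also have "\<dots> = of_bool (u = v) - of_bool (u \<in> l ` {1..n}) * Z u v"
      using Z[OF uv] sum_grounded_lap[OF uv(1), of "\<lambda>w. Z w v"] by simp
    also have "of_bool (u \<in> l ` {1..n}) * Z u v = of_bool (u = l (block v))"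
      using Z_bridge uv(2) block_in(1) by auto
    finally show "(\<Sum>w\<in>E `` {u}. (Z u v - of_bool (block u = block v)) - (Z w v - of_bool (block w = block v)))
        = of_bool (u = v) - of_bool (u = l (block v))" .
  qed
qed

lemma path_arc_in:
  assumes t: "bij_betw t {1..n} {1..n}"
    and xy: "(x, y) \<in> parcs (path_graph n (\<lambda>j. l (t j)))"
  shows "x \<in> l ` {1..n}" "y \<in> l ` {1..n}" "block x \<noteq> block y"
proof -
  obtain j where j: "j \<in> {1..<n}"
      "x = l (t j) \<and> y = l (t (j + 1)) \<or> x = l (t (j + 1)) \<and> y = l (t j)"
    using xy by (auto simp: path_graph_def)
  then have j': "j \<in> {1..n}" "j + 1 \<in> {1..n}" by auto
  then have tj: "t j \<in> {1..n}" "t (j + 1) \<in> {1..n}"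
    using t bij_betwE by blast+
  have "t j \<noteq> t (j + 1)"
    using inj_on_eq_iff[OF bij_betw_imp_inj_on[OF t] j'] by simp
  then show "x \<in> l ` {1..n}" "y \<in> l ` {1..n}" "block x \<noteq> block y"
    using j(2) tj by (auto simp: bridge_in(2) simp del: atLeastAtMost_iff)
qed

lemma path_arcs_subset:
  assumes "bij_betw t {1..n} {1..n}"
  shows "parcs (path_graph n (\<lambda>j. l (t j))) \<subseteq> V \<times> V"
proof (rule subrelI)
  fix x y assume xy: "(x, y) \<in> parcs (path_graph n (\<lambda>j. l (t j)))"
  show "(x, y) \<in> V \<times> V"
    using path_arc_in(1,2)[OF assms xy] bridges_subset by blast
qed

lemma irrefl_path_arcs:
  assumes "bij_betw t {1..n} {1..n}"
  shows "irrefl (parcs (path_graph n (\<lambda>j. l (t j))))"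
proof (rule irreflI)
  show "(x, x) \<notin> parcs (path_graph n (\<lambda>j. l (t j)))" for x
    using path_arc_in(3)[OF assms, of x x] by blast
qed

lemma sym_path_arcs: "sym (parcs (path_graph n p))"
  by (auto simp: path_graph_def sym_def)

text \<open>The function \<open>K u v + min (pos u) (pos v)\<close> solves the Poisson equation of the composite graph,
  with the sink at the bridge in the leftmost position. Along the arcs inside the graphs only \<open>K\<close>
  varies; along the backbone only \<open>min\<close> varies. The first part moves the source from \<open>v\<close> to the
  bridge of its graph, the second moves it from there to the left end of the path.\<close>

lemma composite_green:
  fixes t :: "nat \<Rightarrow> nat" and K :: "'a \<Rightarrow> 'a \<Rightarrow> real"
  defines "pos u \<equiv> inv_into {1..n} t (block u)"
  defines "B \<equiv> parcs (path_graph n (\<lambda>j. l (t j)))"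
  assumes t: "bij_betw t {1..n} {1..n}"
    and K_bridge: "\<And>i v. i \<in> {1..n} \<Longrightarrow> v \<in> V \<Longrightarrow> K (l i) v = 0"
    and K: "\<And>u v. u \<in> V \<Longrightarrow> v \<in> V \<Longrightarrow>
       (\<Sum>w\<in>E `` {u}. K u v - K w v) = of_bool (u = v) - of_bool (u = l (block v))"
    and uv: "u \<in> V" "v \<in> V"
  shows "(\<Sum>w\<in>(E \<union> B) `` {u}. (K u v + min (pos u) (pos v)) - (K w v + min (pos w) (pos v)))
       = of_bool (u = v) - of_bool (u = l (t 1))"
proof -
  define Y where "Y u = K u v + min (pos u) (pos v)" for u
  have tin: "t a \<in> {1..n}" if "a \<in> {1..n}" for a
    using t that by (auto simp: bij_betw_def)
  have inj: "inj_on (\<lambda>j. l (t j)) {1..n}"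
    using comp_inj_on[of t "{1..n}" l] t inj_on_bridge by (simp add: bij_betw_def comp_def)
  have pos_t: "pos (l (t a)) = a" if "a \<in> {1..n}" for a
    using that t tin bridge_in(2) by (simp add: pos_def bij_betw_def inv_into_f_f)
  have t_pos: "pos w \<in> {1..n}" "t (pos w) = block w" if "w \<in> V" for w
    using block_in(1)[OF that] t inv_into_into[of _ t "{1..n}"] f_inv_into_f[of _ t "{1..n}"]
    by (auto simp: pos_def bij_betw_def)
  have n: "1 \<in> {1..n}" using t_pos(1)[OF uv(1)] by auto
  note B_bridge = path_arc_in[OF t, folded B_def]
  have finE: "finite (E `` {u})"
    using E_subset by (intro finite_subset[OF _ finite_V]) auto
  have "B `` {u} \<subseteq> V" using path_arcs_subset[OF t] by (auto simp: B_def)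
  then have finB: "finite (B `` {u})"
    by (intro finite_subset[OF _ finite_V]) auto
  have "E `` {u} \<inter> B `` {u} = {}" using B_bridge E_in(3) by blast
  then have "(\<Sum>w\<in>(E \<union> B) `` {u}. Y u - Y w) = (\<Sum>w\<in>E `` {u}. Y u - Y w) + (\<Sum>w\<in>B `` {u}. Y u - Y w)"
    using finE finB by (simp add: Un_Image sum.union_disjoint)
  also have "(\<Sum>w\<in>E `` {u}. Y u - Y w) = (\<Sum>w\<in>E `` {u}. K u v - K w v)"
    using E_in(3) by (intro sum.cong) (auto simp: Y_def pos_def)
  also have "\<dots> = of_bool (u = v) - of_bool (u = l (block v))"
    using K uv by simp
  also have "(\<Sum>w\<in>B `` {u}. Y u - Y w) = of_bool (u = l (block v)) - of_bool (u = l (t 1))"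
  proof (cases "u \<in> l ` {1..n}")
    case False
    then have "B `` {u} = {}" using B_bridge by blast
    moreover have "u \<noteq> l (block v)" "u \<noteq> l (t 1)"
      using False block_in(1)[OF uv(2)] tin[OF n] by auto
    ultimately show ?thesis by simp
  next
    case True
    define a where "a = pos u"
    have a: "a \<in> {1..n}" "u = l (t a)"
      using t_pos[OF uv(1)] True bridge_in(2) by (auto simp: a_def)
    have "(\<Sum>w\<in>B `` {u}. Y u - Y w) = (\<Sum>b\<in>{a - 1, a + 1} \<inter> {1..n}. Y u - Y (l (t b)))"
      unfolding B_def a(2) path_graph_neighbours[OF inj a(1)]
      by (subst sum.reindex) (auto intro: inj_on_subset[OF inj])
    also have "\<dots> = (\<Sum>b\<in>{a - 1, a + 1} \<inter> {1..n}. real (min a (pos v)) - real (min b (pos v)))"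
      using a tin K_bridge uv(2) pos_t by (intro sum.cong) (auto simp: Y_def)
    also have "\<dots> = of_bool (a = pos v) - of_bool (a = 1)"
      by (rule path_green[OF a(1) t_pos(1)[OF uv(2)]])
    also have "a = pos v \<longleftrightarrow> u = l (block v)"
      using a t_pos[OF uv(2)] inj_on_eq_iff[OF inj, of a "pos v"] by auto
    also have "a = 1 \<longleftrightarrow> u = l (t 1)"
      using a n inj_on_eq_iff[OF inj, of a 1] by auto
    finally show ?thesis .
  qed
  finally show ?thesis by (simp add: Y_def)
qed

text \<open>The ordering enters the coherence only through the total distance along the backbone, weighted by
  the sizes of the graphs, because \<open>K\<close> does not depend on it. The identity
  \<open>\<bar>a - b\<bar> = a + b - 2 min a b\<close> turns the centred trace of \<open>min\<close> into this distance.\<close>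

lemma coherence_path_composite:
  assumes n: "n \<ge> 1"
  shows "\<exists>C. \<forall>t. bij_betw t {1..n} {1..n} \<longrightarrow>
    coherence (composite_graph n G (path_graph n (\<lambda>j. l (t j))))
      = C + (\<Sum>i=1..n. \<Sum>j=1..n. real (card (pverts (G i))) * real (card (pverts (G j)))
               * \<bar>int (inv_into {1..n} t i) - int (inv_into {1..n} t j)\<bar>) / (4 * real (card V))"
proof -
  obtain K :: "'a \<Rightarrow> 'a \<Rightarrow> real" where K_bridge: "\<And>i v. i \<in> {1..n} \<Longrightarrow> v \<in> V \<Longrightarrow> K (l i) v = 0"
    and K: "\<And>u v. u \<in> V \<Longrightarrow> v \<in> V \<Longrightarrow>
       (\<Sum>w\<in>E `` {u}. K u v - K w v) = of_bool (u = v) - of_bool (u = l (block v))"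
    using block_green_exists by blast
  define N where "N = real (card V)"
  have "l 1 \<in> V" using bridge_in n by auto
  then have N: "N > 0" using finite_V by (auto simp: N_def card_gt_0_iff)
  define C where "C = ((\<Sum>v\<in>V. K v v) - (\<Sum>u\<in>V. \<Sum>v\<in>V. K u v) / N) / 2"
  show ?thesis
  proof (intro exI[of _ C] allI impI)
    fix t assume t: "bij_betw t {1..n} {1..n}"
    define H where "H = composite_graph n G (path_graph n (\<lambda>j. l (t j)))"
    define B where "B = parcs (path_graph n (\<lambda>j. l (t j)))"
    define q where "q = inv_into {1..n} t"
    define pos where "pos u = q (block u)" for u
    define Y where "Y u v = K u v + min (pos u) (pos v)" for u v
    have H: "pverts H = V" "parcs H = E \<union> B"
      by (simp_all add: H_def B_def composite_graph_def V_def E_def)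
    \<comment> \<open>Only the vertex set of the composite graph matters for the enumeration, not the backbone.\<close>
    define vs where "vs = vertex_enum H"
    have "\<exists>vs. distinct vs \<and> set vs = pverts H"
      using finite_distinct_list[OF finite_V] H(1) by auto
    then have vs: "distinct vs" "set vs = V"
      using someI_ex[of "\<lambda>vs. distinct vs \<and> set vs = pverts H"] H(1)
      by (auto simp: vs_def vertex_enum_def)
    have ne: "vs \<noteq> []" using vs(2) \<open>l 1 \<in> V\<close> by auto
    have sub: "E \<union> B \<subseteq> V \<times> V"
      unfolding B_def by (rule Un_least[OF E_subset path_arcs_subset[OF t]])
    have irr: "irrefl (E \<union> B)"
      using irrefl_E irrefl_path_arcs[OF t] by (simp add: B_def irrefl_def)
    have sym: "sym (E \<union> B)"
      unfolding B_def by (rule sym_Un[OF sym_E sym_path_arcs])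
    have "mat_trace (pseudo_inverse (kernel_mat vs (lap (E \<union> B))))
        = (\<Sum>v\<in>set vs. Y v v) - (\<Sum>u\<in>set vs. \<Sum>v\<in>set vs. Y u v) / card (set vs)"
    proof (rule trace_pseudo_inverse_kernel_mat[OF vs(1) ne], unfold vs(2))
      show "lap (E \<union> B) u v = lap (E \<union> B) v u" for u v by (rule lap_symmetric[OF sym])
      show "(\<Sum>v\<in>V. lap (E \<union> B) u v) = 0" if "u \<in> V" for u
        using sum_lap[OF finite_V sub irr that, of "\<lambda>_. 1"] by simp
      show "(\<Sum>w\<in>V. lap (E \<union> B) u w * Y w v) = of_bool (u = v) - of_bool (u = l (t 1))"
        if "u \<in> V" "v \<in> V" for u v
        using sum_lap[OF finite_V sub irr that(1), of "\<lambda>w. Y w v"]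
          composite_green[OF t K_bridge K that]
        by (simp add: Y_def pos_def q_def B_def)
    qed
    then have "coherence H = ((\<Sum>v\<in>V. Y v v) - (\<Sum>u\<in>V. \<Sum>v\<in>V. Y u v) / N) / 2"
      by (simp add: coherence_def vs_def[symmetric] laplacian_mat_eq_kernel_mat[OF vs(1)] H(2) vs(2) N_def)
    also have "\<dots> = C + ((\<Sum>v\<in>V. real (pos v)) - (\<Sum>u\<in>V. \<Sum>v\<in>V. real (min (pos u) (pos v))) / N) / 2"
      by (simp add: Y_def C_def sum.distrib add_divide_distrib diff_divide_distrib)
    also have "(\<Sum>v\<in>V. real (pos v)) - (\<Sum>u\<in>V. \<Sum>v\<in>V. real (min (pos u) (pos v))) / N
        = (\<Sum>u\<in>V. \<Sum>v\<in>V. real_of_int \<bar>int (pos u) - int (pos v)\<bar>) / (2 * N)"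
    proof -
      have "(\<Sum>u\<in>V. \<Sum>v\<in>V. real_of_int \<bar>int (pos u) - int (pos v)\<bar>)
          = (\<Sum>u\<in>V. \<Sum>v\<in>V. real (pos u) + real (pos v) - 2 * real (min (pos u) (pos v)))"
        by (intro sum.cong refl) (auto simp: min_def)
      also have "\<dots> = 2 * (N * (\<Sum>v\<in>V. real (pos v))) - 2 * (\<Sum>u\<in>V. \<Sum>v\<in>V. real (min (pos u) (pos v)))"
        by (simp add: sum_subtractf sum.distrib sum_distrib_left[symmetric] N_def)
      finally have D: "(\<Sum>u\<in>V. \<Sum>v\<in>V. real_of_int \<bar>int (pos u) - int (pos v)\<bar>) = \<dots>" .
      show ?thesis unfolding D using N by (simp add: diff_divide_distrib)
    qed
    also have "(\<Sum>u\<in>V. \<Sum>v\<in>V. real_of_int \<bar>int (pos u) - int (pos v)\<bar>)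
        = (\<Sum>u\<in>V. \<Sum>j=1..n. real (card (pverts (G j))) * real_of_int \<bar>int (pos u) - int (q j)\<bar>)"
      unfolding pos_def by (rule sum.cong[OF refl], rule sum_over_blocks)
    also have "\<dots> = (\<Sum>i=1..n. real (card (pverts (G i))) *
        (\<Sum>j=1..n. real (card (pverts (G j))) * real_of_int \<bar>int (q i) - int (q j)\<bar>))"
      unfolding pos_def by (rule sum_over_blocks)
    also have "\<dots> = (\<Sum>i=1..n. \<Sum>j=1..n. real (card (pverts (G i))) * real (card (pverts (G j)))
        * \<bar>int (q i) - int (q j)\<bar>)"
      by (simp only: sum_distrib_left mult.assoc)
    finally show "coherence (composite_graph n G (path_graph n (\<lambda>j. l (t j))))
      = C + (\<Sum>i=1..n. \<Sum>j=1..n. real (card (pverts (G i))) * real (card (pverts (G j)))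
               * \<bar>int (inv_into {1..n} t i) - int (inv_into {1..n} t j)\<bar>) / (4 * real (card V))"
      by (simp add: H_def q_def N_def)
  qed
qed

end

section \<open>A rearrangement inequality for distances on the line\<close>

text \<open>Distances between unweighted sets of positions; the weighted problem is reduced to them below.\<close>

definition total_distance :: "int set \<Rightarrow> int set \<Rightarrow> int" where
  "total_distance A B = (\<Sum>a\<in>A. \<Sum>b\<in>B. \<bar>a - b\<bar>)"

lemma total_distance_commute: "total_distance A B = total_distance B A"
  unfolding total_distance_def by (subst sum.swap) (simp add: abs_minus_commute)

text \<open>The \<open>k\<close> integers closest to \<open>c\<close>, where the right neighbour precedes the left one when \<open>k\<close> is even.
  Division rounds downwards, so \<open>k = 0\<close> gives the empty interval \<open>{c + 1 .. c}\<close>.\<close>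

definition centred_interval :: "int \<Rightarrow> nat \<Rightarrow> int set" where
  "centred_interval c k = {c - (int k - 1) div 2 .. c + int k div 2}"

lemma card_centred_interval: "card (centred_interval c k) = k"
proof -
  have "int k div 2 + (int k - 1) div 2 + 1 = int k" by presburger
  then show ?thesis by (simp add: centred_interval_def)
qed

lemma finite_centred_interval [simp]: "finite (centred_interval c k)"
  by (simp add: centred_interval_def)

text \<open>Every \<open>a\<close> has total distance at least \<open>Max B - Min B\<close> to the two extremes of \<open>B\<close>, and \<open>card B\<close>
  integers spread over at least \<open>card B - 1\<close> unit steps. For a singleton \<open>B\<close> the bound is trivial.\<close>

lemma total_distance_remove_extremes:
  assumes "finite B" "B \<noteq> {}"
  shows "total_distance A (B - {Min B, Max B})
           + int (card A) * (int (card B) - 1) \<le> total_distance A B"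
proof -
  have "B \<subseteq> {Min B..Max B}" using assms by auto
  then have "card B \<le> nat (Max B - Min B + 1)"
    using card_mono[of "{Min B..Max B}" B] by simp
  moreover have mM: "Min B \<le> Max B" using assms by simp
  ultimately have w: "int (card B) - 1 \<le> Max B - Min B" by linarith
  have "(\<Sum>b\<in>B - {Min B, Max B}. \<bar>a - b\<bar>) + (int (card B) - 1) \<le> (\<Sum>b\<in>B. \<bar>a - b\<bar>)" for a
  proof -
    have "(\<Sum>b\<in>B. \<bar>a - b\<bar>) = (\<Sum>b\<in>B - {Min B, Max B}. \<bar>a - b\<bar>) + (\<Sum>b\<in>{Min B, Max B}. \<bar>a - b\<bar>)"
      using assms by (subst sum.subset_diff[of "{Min B, Max B}"]) auto
    moreover have "Max B - Min B \<le> (\<Sum>b\<in>{Min B, Max B}. \<bar>a - b\<bar>)"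
      by (cases "Min B = Max B") auto
    ultimately show ?thesis using w by linarith
  qed
  then have "(\<Sum>a\<in>A. (\<Sum>b\<in>B - {Min B, Max B}. \<bar>a - b\<bar>) + (int (card B) - 1)) \<le> total_distance A B"
    unfolding total_distance_def by (intro sum_mono)
  then show ?thesis by (simp add: total_distance_def sum.distrib)
qed

text \<open>The estimate in \<open>total_distance_remove_extremes\<close> is an equality for centred intervals when the
  larger one loses its end points: the smaller interval lies between them, there are no gaps, and
  what remains is again a centred interval.\<close>

lemma total_distance_centred_interval:
  assumes "k \<le> l" "0 < l"
  shows "total_distance (centred_interval c k) (centred_interval c l)
       = total_distance (centred_interval c k) (centred_interval c (l - 2)) + int k * (int l - 1)"
proof -
  let ?I = "centred_interval c k" and ?J = "centred_interval c l"
  define x y where "x = c - (int l - 1) div 2" and "y = c + int l div 2"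
  have xy: "x \<le> y" "y - x = int l - 1"
    using assms(2) unfolding x_def y_def by presburger+
  have J: "?J = {x..y}" by (simp add: centred_interval_def x_def y_def)
  have J': "centred_interval c (l - 2) = {x..y} - {x, y}"
  proof (cases "l = 1")
    case True
    then show ?thesis by (auto simp: centred_interval_def x_def y_def)
  next
    case False
    then have "c - (int (l - 2) - 1) div 2 = x + 1" "c + int (l - 2) div 2 = y - 1"
      using assms(2) by (simp_all add: x_def y_def of_nat_diff)
    then show ?thesis unfolding centred_interval_def by auto
  qed
  have I: "x \<le> a \<and> a \<le> y" if "a \<in> ?I" for a
  proof -
    have "(int k - 1) div 2 \<le> (int l - 1) div 2" "int k div 2 \<le> int l div 2"
      using assms(1) by (auto intro: zdiv_mono1)
    then show ?thesis using that by (auto simp: centred_interval_def x_def y_def)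
  qed
  have "(\<Sum>b\<in>?J. \<bar>a - b\<bar>) = (\<Sum>b\<in>{x..y} - {x, y}. \<bar>a - b\<bar>) + (int l - 1)" if "a \<in> ?I" for a
  proof -
    have "(\<Sum>b\<in>?J. \<bar>a - b\<bar>) = (\<Sum>b\<in>{x..y} - {x, y}. \<bar>a - b\<bar>) + (\<Sum>b\<in>{x, y}. \<bar>a - b\<bar>)"
      unfolding J using xy by (subst sum.subset_diff[of "{x, y}"]) auto
    moreover have "(\<Sum>b\<in>{x, y}. \<bar>a - b\<bar>) = int l - 1"
      using I[OF that] xy by (cases "x = y") auto
    ultimately show ?thesis by simp
  qed
  then show ?thesis
    unfolding J' total_distance_def by (simp add: sum.distrib card_centred_interval)
qed

text \<open>A discrete Riesz rearrangement inequality. Removing the extremes of the larger set costs at least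
  as much for \<open>A\<close> and \<open>B\<close> as it does for the centred intervals, and induction handles the rest.
  Always shrinking the larger set keeps the inner centred interval between the removed end points,
  where the estimate is sharp.\<close>

lemma total_distance_ge_centred:
  assumes "finite A" "finite B"
  shows "total_distance (centred_interval c (card A)) (centred_interval c (card B))
       \<le> total_distance A B"
  using assms
proof (induction "card A + card B" arbitrary: A B rule: less_induct)
  case less
  have step: "total_distance (centred_interval c (card A)) (centred_interval c (card B))
                \<le> total_distance A B"
    if IH: "\<And>B'. finite B' \<Longrightarrow> card B' < card B \<Longrightarrow>
              total_distance (centred_interval c (card A)) (centred_interval c (card B'))
              \<le> total_distance A B'"
      and AB: "finite B" "card A \<le> card B"
    for A B :: "int set"
  proof (cases "B = {}")
    case True
    then show ?thesis by (simp add: total_distance_def centred_interval_def)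
  next
    case False
    let ?B = "B - {Min B, Max B}"
    have card: "card B > 0" using AB False by auto
    have cB: "card ?B = card B - 2"
    proof (cases "Min B = Max B")
      case True
      have "b = Max B" if "b \<in> B" for b
        using that AB(1) True by (metis Max_ge Min_le order_antisym)
      with False have "B = {Max B}" by auto
      then have "card B = 1" "?B = {}" by (metis is_singletonI is_singleton_altdef, auto)
      show ?thesis
        using \<open>card B = 1\<close> by (subst \<open>?B = {}\<close>) simp
    next
      case ne: False
      then show ?thesis using AB(1) False by (subst card_Diff_subset) auto
    qed
    have "total_distance (centred_interval c (card A)) (centred_interval c (card B))
        = total_distance (centred_interval c (card A)) (centred_interval c (card ?B))
          + int (card A) * (int (card B) - 1)"
      using total_distance_centred_interval AB(2) card cB by simp
    also have "\<dots> \<le> total_distance A ?B + int (card A) * (int (card B) - 1)"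
      using IH[of ?B] AB(1) cB card by simp
    also have "\<dots> \<le> total_distance A B"
      using total_distance_remove_extremes AB(1) False by blast
    finally show ?thesis .
  qed
  show ?case
  proof (cases "card A \<le> card B")
    case True
    show ?thesis by (rule step) (use less True in auto)
  next
    case False
    have "total_distance (centred_interval c (card B)) (centred_interval c (card A))
        \<le> total_distance B A"
    proof (rule step)
      fix B' :: "int set" assume "finite B'" "card B' < card A"
      then have "total_distance (centred_interval c (card B')) (centred_interval c (card B))
          \<le> total_distance B' B"
        using less by auto
      then show "total_distance (centred_interval c (card B)) (centred_interval c (card B'))
          \<le> total_distance B B'"
        by (simp add: total_distance_commute)
    qed (use less False in auto)
    then show ?thesis by (simp add: total_distance_commute)
  qed
qed

text \<open>Summation by parts in both indices. The weight \<open>m i\<close> is the sum of the increments \<open>d k\<close> over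
  \<open>k \<ge> i\<close> (with the last weight as the last increment), so the weighted distance is a combination
  of distances between the sets of positions of the first \<open>k\<close> and the first \<open>l\<close> items.\<close>

lemma weighted_distance_abel:
  fixes m :: "nat \<Rightarrow> real" and q :: "nat \<Rightarrow> int"
  assumes "inj_on q {1..n}"
  defines "d \<equiv> \<lambda>k. if k = n then m n else m k - m (k + 1)"
  shows "(\<Sum>i=1..n. \<Sum>j=1..n. m i * m j * \<bar>q i - q j\<bar>)
       = (\<Sum>k=1..n. \<Sum>l=1..n. d k * d l * total_distance (q ` {1..k}) (q ` {1..l}))"
proof -
  have m: "m i = (\<Sum>k=1..n. d k * of_bool (i \<le> k))" if "i \<in> {1..n}" for i
  proof -
    have "(\<Sum>k=1..n. d k * of_bool (i \<le> k)) = (\<Sum>k=i..n. d k)"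
      using that by (intro sum.mono_neutral_cong_right) auto
    also have "\<dots> = (\<Sum>k=i..<n. m k - m (Suc k)) + m n"
      using that by (subst sum.last_plus) (auto simp: d_def)
    also have "(\<Sum>k=i..<n. m k - m (Suc k)) = m i - m n"
      using that sum_Suc_diff'[of i n m] by (simp add: sum_subtractf algebra_simps)
    finally show ?thesis by simp
  qed
  have td: "real_of_int (total_distance (q ` {1..k}) (q ` {1..l}))
      = (\<Sum>i=1..n. \<Sum>j=1..n. of_bool (i \<le> k) * of_bool (j \<le> l) * real_of_int \<bar>q i - q j\<bar>)"
    if "k \<le> n" "l \<le> n" for k l
  proof -
    have inj: "inj_on q {1..k}" "inj_on q {1..l}"
      using that by (auto intro: inj_on_subset[OF assms(1)])
    have "real_of_int (total_distance (q ` {1..k}) (q ` {1..l}))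
        = (\<Sum>i=1..k. \<Sum>j=1..l. real_of_int \<bar>q i - q j\<bar>)"
      by (simp add: total_distance_def sum.reindex[OF inj(1)] sum.reindex[OF inj(2)] del: One_nat_def)
    also have "\<dots> = (\<Sum>i=1..k. \<Sum>j=1..n. of_bool (j \<le> l) * real_of_int \<bar>q i - q j\<bar>)"
      using that by (intro sum.cong sum.mono_neutral_cong_left) auto
    also have "\<dots> = (\<Sum>i=1..n. \<Sum>j=1..n. of_bool (i \<le> k) * of_bool (j \<le> l) * real_of_int \<bar>q i - q j\<bar>)"
      using that by (intro sum.mono_neutral_cong_left) auto
    finally show ?thesis by simp
  qed
  have "(\<Sum>i=1..n. \<Sum>j=1..n. m i * m j * \<bar>q i - q j\<bar>)
      = (\<Sum>i=1..n. \<Sum>j=1..n. (\<Sum>k=1..n. d k * of_bool (i \<le> k)) * (\<Sum>l=1..n. d l * of_bool (j \<le> l))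
          * \<bar>q i - q j\<bar>)"
    using m by (intro sum.cong refl) simp
  also have "\<dots> = (\<Sum>i=1..n. \<Sum>j=1..n. \<Sum>k=1..n. \<Sum>l=1..n.
      d k * of_bool (i \<le> k) * (d l * of_bool (j \<le> l)) * \<bar>q i - q j\<bar>)"
    by (simp only: sum_product) (simp only: sum_distrib_right)
  also have "\<dots> = (\<Sum>i=1..n. \<Sum>k=1..n. \<Sum>l=1..n. \<Sum>j=1..n.
      d k * of_bool (i \<le> k) * (d l * of_bool (j \<le> l)) * \<bar>q i - q j\<bar>)"
    by (rule sum.cong[OF refl], rule trans[OF sum.swap], rule sum.cong[OF refl], rule sum.swap)
  also have "\<dots> = (\<Sum>k=1..n. \<Sum>l=1..n. \<Sum>i=1..n. \<Sum>j=1..n.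
      d k * of_bool (i \<le> k) * (d l * of_bool (j \<le> l)) * \<bar>q i - q j\<bar>)"
    by (rule trans[OF sum.swap], rule sum.cong[OF refl], rule sum.swap)
  also have "\<dots> = (\<Sum>k=1..n. \<Sum>l=1..n. d k * d l * total_distance (q ` {1..k}) (q ` {1..l}))"
  proof (intro sum.cong refl)
    fix k l assume "k \<in> {1..n}" "l \<in> {1..n}"
    then show "(\<Sum>i=1..n. \<Sum>j=1..n. d k * of_bool (i \<le> k) * (d l * of_bool (j \<le> l)) * real_of_int \<bar>q i - q j\<bar>)
        = d k * d l * total_distance (q ` {1..k}) (q ` {1..l})"
      by (subst td) (simp, simp, simp only: sum_distrib_left mult_ac)
  qed
  finally show ?thesis .
qed

text \<open>For decreasing weights the coefficients in \<open>weighted_distance_abel\<close> are nonnegative, so an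
  arrangement in which the first \<open>k\<close> items always form a centred interval minimises all terms at
  once.\<close>

lemma weighted_distance_minimal:
  fixes m :: "nat \<Rightarrow> real" and q q' :: "nat \<Rightarrow> int"
  assumes mono: "\<And>i j. 1 \<le> i \<Longrightarrow> i \<le> j \<Longrightarrow> j \<le> n \<Longrightarrow> m j \<le> m i"
    and nonneg: "\<And>i. 1 \<le> i \<Longrightarrow> i \<le> n \<Longrightarrow> 0 \<le> m i"
    and inj: "inj_on q {1..n}" "inj_on q' {1..n}"
    and centred: "\<And>k. k \<le> n \<Longrightarrow> q ` {1..k} = centred_interval c k"
  shows "(\<Sum>i=1..n. \<Sum>j=1..n. m i * m j * \<bar>q i - q j\<bar>)
       \<le> (\<Sum>i=1..n. \<Sum>j=1..n. m i * m j * \<bar>q' i - q' j\<bar>)"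
proof -
  let ?d = "\<lambda>k. if k = n then m n else m k - m (k + 1)"
  have d: "0 \<le> ?d k" if "k \<in> {1..n}" for k
    using that mono[of k "k + 1"] nonneg[of n] by auto
  have "total_distance (q ` {1..k}) (q ` {1..l}) \<le> total_distance (q' ` {1..k}) (q' ` {1..l})"
    if "k \<in> {1..n}" "l \<in> {1..n}" for k l
  proof -
    have "card (q' ` {1..k}) = k" "card (q' ` {1..l}) = l"
      using that inj(2) by (auto simp: card_image inj_on_subset)
    with total_distance_ge_centred[of "q' ` {1..k}" "q' ` {1..l}" c] show ?thesis
      using that centred by simp
  qed
  then show ?thesis
    unfolding weighted_distance_abel[OF inj(1)] weighted_distance_abel[OF inj(2)]
    by (intro sum_mono mult_left_mono mult_nonneg_nonneg of_int_le_iff[THEN iffD2] d)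
qed

text \<open>Placing the items alternately to the right and to the left of \<open>c\<close> extends a centred interval to
  the next one at every step.\<close>

lemma image_zigzag:
  fixes c :: int
  defines "q \<equiv> \<lambda>i. if even i then c + int i div 2 else c - int i div 2"
  shows "q ` {1..k} = centred_interval c k"
proof (induction k)
  case 0
  then show ?case by (simp add: centred_interval_def)
next
  case (Suc k)
  have "q ` {1..Suc k} = insert (q (Suc k)) (centred_interval c k)"
    using Suc.IH by (simp add: atLeastAtMostSuc_conv)
  also have "\<dots> = centred_interval c (Suc k)"
  proof (cases "even k")
    case True
    then obtain j where "k = 2 * j" by (elim evenE)
    then show ?thesis by (auto simp: centred_interval_def q_def)
  next
    case False
    then obtain j where "k = 2 * j + 1" by (elim oddE)
    then show ?thesis by (auto simp: centred_interval_def q_def)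
  qed
  finally show ?case .
qed

section \<open>The optimal ordering\<close>

theorem corollary2:
  fixes n c :: nat
    and G :: "nat \<Rightarrow> 'a pair_pre_digraph"
    and l :: "nat \<Rightarrow> 'a"
    and s :: "nat \<Rightarrow> nat"
  assumes n: "n \<ge> 1"
    and graphs: "\<And>i. i \<in> {1..n} \<Longrightarrow> pair_graph (G i)"
    and conn: "\<And>i. i \<in> {1..n} \<Longrightarrow> Digraph_Component.connected (with_proj (G i))"
    and disj: "\<And>i j. i \<in> {1..n} \<Longrightarrow> j \<in> {1..n} \<Longrightarrow> i \<noteq> j \<Longrightarrow>
                 pverts (G i) \<inter> pverts (G j) = {}"
    and bridge: "\<And>i. i \<in> {1..n} \<Longrightarrow> l i \<in> pverts (G i)"
    and sizes: "\<And>i j. 1 \<le> i \<Longrightarrow> i \<le> j \<Longrightarrow> j \<le> n \<Longrightarrow>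
                 card (pverts (G j)) \<le> card (pverts (G i))"
    and c: "c = nat \<lceil>real n / 2\<rceil>"
    and s_mid: "s c = 1"
    and s_right: "\<And>k. 1 \<le> k \<Longrightarrow> 2 * k \<le> n \<Longrightarrow> s (c + k) = 2 * k"
    and s_left: "\<And>k. 1 \<le> k \<Longrightarrow> 2 * k + 1 \<le> n \<Longrightarrow> s (c - k) = 2 * k + 1"
  shows "is_arg_min
           (\<lambda>t. coherence (composite_graph n G (path_graph n (\<lambda>j. l (t j)))))
           (\<lambda>t. bij_betw t {1..n} {1..n}) s"
proof -
  interpret bridged_graphs n G l
    by (rule bridged_graphs.intro[OF graphs conn disj bridge])
  have c': "c = (n + 1) div 2"
  proof (cases "even n")
    case True
    then obtain j where "n = 2 * j" by (elim evenE)
    then show ?thesis unfolding c by simp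
  next
    case False
    then obtain j where j: "n = 2 * j + 1" by (elim oddE)
    have "\<lceil>real n / 2\<rceil> = int j + 1" unfolding j by (intro ceiling_unique) auto
    then show ?thesis unfolding c j by simp
  qed
  \<comment> \<open>\<open>q i\<close> is the position at which \<open>s\<close> places graph \<open>i\<close>.\<close>
  define q where "q i = (if even i then c + i div 2 else c - i div 2)" for i
  have q_in: "q i \<in> {1..n}" and s_q: "s (q i) = i" if "i \<in> {1..n}" for i
  proof -
    show "q i \<in> {1..n}"
      using that unfolding q_def c' by (auto elim!: evenE oddE)
    have "i = 2 * (i div 2) \<and> 1 \<le> i div 2 \<or> i = 1 \<or> i = 2 * (i div 2) + 1 \<and> 1 \<le> i div 2"
      using that unfolding atLeastAtMost_iff by presburger
    then consider k where "i = 2 * k" "1 \<le> k" | "i = 1" | k where "i = 2 * k + 1" "1 \<le> k"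
      by blast
    then show "s (q i) = i"
      using that s_mid s_right s_left by cases (simp_all add: q_def)
  qed
  have q_inj: "inj_on q {1..n}" using s_q by (rule inj_on_inverseI)
  have "q ` {1..n} = {1..n}"
    by (rule endo_inj_surj[OF finite_atLeastAtMost image_subsetI[OF q_in] q_inj])
  with q_inj have q_bij: "bij_betw q {1..n} {1..n}" by (simp only: bij_betw_def)
  have "s x = inv_into {1..n} q x" if "x \<in> {1..n}" for x
  proof -
    from that have "x \<in> q ` {1..n}" by (simp only: \<open>q ` {1..n} = {1..n}\<close>)
    then obtain i where i: "x = q i" "i \<in> {1..n}" by (rule imageE)
    show ?thesis by (simp only: i(1) s_q[OF i(2)] inv_into_f_f[OF q_inj i(2)])
  qed
  then have s_bij: "bij_betw s {1..n} {1..n}"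
    by (rule iffD2[OF bij_betw_cong bij_betw_inv_into[OF q_bij]])
  have s_inv: "inv_into {1..n} s i = q i" if "i \<in> {1..n}" for i
    using inv_into_f_eq[OF bij_betw_imp_inj_on[OF s_bij] q_in[OF that] s_q[OF that]] .
  have centred: "(\<lambda>i. int (inv_into {1..n} s i)) ` {1..k} = centred_interval (int c) k" if "k \<le> n" for k
  proof -
    have "int (inv_into {1..n} s i) = (if even i then int c + int i div 2 else int c - int i div 2)"
      if "i \<in> {1..k}" for i
    proof -
      have i: "i \<in> {1..n}" using that \<open>k \<le> n\<close> by auto
      then have "i div 2 \<le> c" unfolding c' by auto
      then show ?thesis unfolding s_inv[OF i] q_def by (simp add: of_nat_diff zdiv_int)
    qed
    then show ?thesis
      unfolding image_zigzag[symmetric] by (intro image_cong refl)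
  qed
  obtain C where C: "\<forall>t. bij_betw t {1..n} {1..n} \<longrightarrow>
    coherence (composite_graph n G (path_graph n (\<lambda>j. l (t j))))
      = C + (\<Sum>i=1..n. \<Sum>j=1..n. real (card (pverts (G i))) * real (card (pverts (G j)))
               * \<bar>int (inv_into {1..n} t i) - int (inv_into {1..n} t j)\<bar>) / (4 * real (card V))"
    using coherence_path_composite[OF n] by (rule exE)
  have "coherence (composite_graph n G (path_graph n (\<lambda>j. l (s j))))
      \<le> coherence (composite_graph n G (path_graph n (\<lambda>j. l (t j))))"
    if t: "bij_betw t {1..n} {1..n}" for t
  proof -
    have inj: "inj_on (\<lambda>i. int (inv_into {1..n} u i)) {1..n}" if "bij_betw u {1..n} {1..n}" for u
      using bij_betw_imp_inj_on[OF bij_betw_inv_into[OF that]]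
      unfolding inj_on_def of_nat_eq_iff .
    have "(\<Sum>i=1..n. \<Sum>j=1..n. real (card (pverts (G i))) * real (card (pverts (G j)))
            * \<bar>int (inv_into {1..n} s i) - int (inv_into {1..n} s j)\<bar>)
        \<le> (\<Sum>i=1..n. \<Sum>j=1..n. real (card (pverts (G i))) * real (card (pverts (G j)))
            * \<bar>int (inv_into {1..n} t i) - int (inv_into {1..n} t j)\<bar>)"
    proof (rule weighted_distance_minimal[OF _ _ inj[OF s_bij] inj[OF t] centred])
      show "real (card (pverts (G j))) \<le> real (card (pverts (G i)))" if "1 \<le> i" "i \<le> j" "j \<le> n" for i j
        by (rule of_nat_mono[OF sizes[OF that]])
    qed (rule of_nat_0_le_iff)
    then show ?thesis
      unfolding C[rule_format, OF s_bij] C[rule_format, OF t]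
      by (intro add_left_mono divide_right_mono) simp_all
  qed
  then show ?thesis
    unfolding is_arg_min_def using s_bij by (meson not_less)
qed

end
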